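(* Let $p\in(1,\infty)$, let $(X,\mathcal{X},\mu,\mathcal{E}_p,\mathcal{F}_p,\Gamma_p)$ be a $p$-Dirichlet structure and let $n\in\mathbb{N}$. For every Lipschitz function $g:\mathbb{R}^n\to\mathbb{R}$ with $g(0)=0$ and every $f=(f_1,\dots,f_n)\in\mathcal{F}_p^n$ we have $g\circ f\in\mathcal{F}_p$ and $$\Gamma_p\langle g\circ f\rangle\le\big(1\vee n^{(p-2)/2}\big)(\mathrm{Lip}_a[g]\circ f)^p\cdot\sum_{i=1}^n\Gamma_p\langle f_i\rangle.$$
   Context: For a Lipschitz function $g$ on $\mathbb{R}^n$ (Euclidean distance), $\mathrm{LIP}[g|_E]$ is the smallest Lipschitz constant of $g$ on $E$ and $\mathrm{Lip}_a[g](y)=\lim_{r\to0}\mathrm{LIP}[g|_{B(y,r)}]$ (a Borel function of $y$). $\mathrm{Lip}(\mathbb{R})$ is the space of real-valued Lipschitz functions on $\mathbb{R}$. Inequalities between measures are setwise, and $u\cdot\nu$ (or $u\,\nu$) is the measure with density $u$ with respect to $\nu$. $a\vee b=\max(a,b)$. A $p$-Dirichlet structure $(X,\mathcal{X},\mu,\mathcal{E}_p,\mathcal{F}_p,\Gamma_p)$ satisfies: (1) $(X,\mathcal{X},\mu)$ is a probability space and $\mathcal{F}_p$ is a linear subspace of $L^p(X,\mu)$ with $\mathbf{1}_X\in\mathcal{F}_p$. (2) $\mathcal{E}_p:\mathcal{F}_p\to[0,\infty)$, $\mathcal{E}_p^{1/p}$ is a seminorm on $\mathcal{F}_p$, and $\mathcal{F}_p$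 is a Banach space with norm $\|f\|_{\mathcal{F}_p}=(\|f\|_{L^p}^p+\mathcal{E}_p(f))^{1/p}$. (3) For each $f\in\mathcal{F}_p$ there is a finite nonnegative measure $\Gamma_p\langle f\rangle$ on $(X,\mathcal{X})$ with $\Gamma_p\langle f\rangle(X)=\mathcal{E}_p(f)$ and $\Gamma_p\langle\lambda f\rangle=|\lambda|^p\Gamma_p\langle f\rangle$ for all $\lambda\in\mathbb{R}$. (4) $\Gamma_p\langle f\rangle\ll\mu$ for all $f\in\mathcal{F}_p$. (5) $\Gamma_p\langle f+g\rangle(A)^{1/p}\le\Gamma_p\langle f\rangle(A)^{1/p}+\Gamma_p\langle g\rangle(A)^{1/p}$ for all $f,g\in\mathcal{F}_p$, $A\in\mathcal{X}$. (6) For all $f\in\mathcal{F}_p$ and $g\in\mathrm{Lip}(\mathbb{R})$ with $g(0)=0$: $g\circ f\in\mathcal{F}_p$ and $\Gamma_p\langle g\circ f\rangle\le(\mathrm{Lip}_a[g]\circ f)^p\,\Gamma_p\langle f\rangle$. (7) If $f\in\mathcal{F}_p$, $A\in\mathcal{X}$ and $f|_A$ equals a constant $\mu$-a.e., then $\Gamma_p\langle f\rangle(A)=0$. (8) If $f\in L^p(X,\mu)$, $f_i\in\mathcal{F}_p$, $f_i\to f$ in $L^p$ and $\sup_i\mathcal{E}_p(f_i)<\infty$, then $f\in\mathcal{F}_p$ and $\Gamma_p\langle f\rangle(A)\le\liminf_i\Gamma_p\langle f_i\rangle(A)$ for every $A\in\mathcal{X}$. *)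

theory Defs
  imports "HOL-Probability.Probability"
begin

definition LIP :: "('b::metric_space \<Rightarrow> real) \<Rightarrow> 'b set \<Rightarrow> real" where
  "LIP g S = Inf {L. L-lipschitz_on S g}"

definition Lip_a :: "('b::metric_space \<Rightarrow> real) \<Rightarrow> 'b \<Rightarrow> real" where
  "Lip_a g y = Lim (at_right 0) (\<lambda>r. LIP g (ball y r))"

definition Lp_space :: "real \<Rightarrow> 'a measure \<Rightarrow> ('a \<Rightarrow> real) set" where
  "Lp_space p M = {f \<in> borel_measurable M. integrable M (\<lambda>x. \<bar>f x\<bar> powr p)}"

definition Lp_norm :: "real \<Rightarrow> 'a measure \<Rightarrow> ('a \<Rightarrow> real) \<Rightarrow> real" where
  "Lp_norm p M f = (LINT x|M. \<bar>f x\<bar> powr p) powr (1 / p)"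

definition measure_le :: "'a measure \<Rightarrow> 'a measure \<Rightarrow> bool" where
  "measure_le N N' \<longleftrightarrow> sets N = sets N' \<and> (\<forall>A\<in>sets N. emeasure N A \<le> emeasure N' A)"

definition sum_measure :: "'a measure \<Rightarrow> 'i set \<Rightarrow> ('i \<Rightarrow> 'a measure) \<Rightarrow> 'a measure" where
  "sum_measure M I N = measure_of (space M) (sets M) (\<lambda>A. \<Sum>i\<in>I. emeasure (N i) A)"

text \<open>
  Elements of \<open>L\<^sup>p\<close> are represented by functions rather than by almost-everywhere classes.
  The domain \<open>F\<close> is therefore a set of functions closed under almost-everywhere equality,
  and \<open>E\<close> and \<open>\<Gamma>\<close> take equal values on almost everywhere equal functions (assumption
  \<open>AE_class\<close>). Values of \<open>E\<close> and \<open>\<Gamma>\<close> outside \<open>F\<close> are irrelevant. Completeness refers to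
  the norm induced on almost-everywhere classes; that it is a norm there follows from
  the seminorm assumptions on \<open>E\<close>.
\<close>

locale p_dirichlet_structure = prob_space M
  for p :: real
    and M :: "'a measure"
    and E :: "('a \<Rightarrow> real) \<Rightarrow> real"
    and F :: "('a \<Rightarrow> real) set"
    and \<Gamma> :: "('a \<Rightarrow> real) \<Rightarrow> 'a measure" +
  assumes AE_class:
      "\<And>f h. \<lbrakk>f \<in> F; h \<in> borel_measurable M; AE x in M. h x = f x\<rbrakk>
        \<Longrightarrow> h \<in> F \<and> E h = E f \<and> \<Gamma> h = \<Gamma> f"
    and F_subset_Lp: "F \<subseteq> Lp_space p M"
    and F_zero: "(\<lambda>x. 0) \<in> F"
    and F_add: "\<And>f h. \<lbrakk>f \<in> F; h \<in> F\<rbrakk> \<Longrightarrow> (\<lambda>x. f x + h x) \<in> F"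
    and F_scale: "\<And>f c. f \<in> F \<Longrightarrow> (\<lambda>x. c * f x) \<in> F"
    and F_one: "(\<lambda>x. 1) \<in> F"
    and E_nonneg: "\<And>f. f \<in> F \<Longrightarrow> 0 \<le> E f"
    and E_scale: "\<And>f c. f \<in> F \<Longrightarrow> E (\<lambda>x. c * f x) powr (1 / p) = \<bar>c\<bar> * E f powr (1 / p)"
    and E_triangle: "\<And>f h. \<lbrakk>f \<in> F; h \<in> F\<rbrakk> \<Longrightarrow>
      E (\<lambda>x. f x + h x) powr (1 / p) \<le> E f powr (1 / p) + E h powr (1 / p)"
    and F_complete: "\<And>u.
      \<lbrakk>\<And>i::nat. u i \<in> F;
       \<And>e. e > 0 \<Longrightarrow> \<exists>N. \<forall>i\<ge>N. \<forall>j\<ge>N.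
         (Lp_norm p M (\<lambda>x. u i x - u j x) powr p + E (\<lambda>x. u i x - u j x)) powr (1 / p) < e\<rbrakk>
      \<Longrightarrow> \<exists>f\<in>F. (\<lambda>i. (Lp_norm p M (\<lambda>x. u i x - f x) powr p
                        + E (\<lambda>x. u i x - f x)) powr (1 / p)) \<longlonglongrightarrow> 0"
    and \<Gamma>_sets: "\<And>f. f \<in> F \<Longrightarrow> sets (\<Gamma> f) = sets M"
    and \<Gamma>_finite: "\<And>f. f \<in> F \<Longrightarrow> finite_measure (\<Gamma> f)"
    and \<Gamma>_total: "\<And>f. f \<in> F \<Longrightarrow> measure (\<Gamma> f) (space M) = E f"
    and \<Gamma>_scale: "\<And>f c. f \<in> F \<Longrightarrow>
      \<Gamma> (\<lambda>x. c * f x) = scale_measure (ennreal (\<bar>c\<bar> powr p)) (\<Gamma> f)"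
    and \<Gamma>_absolutely_continuous: "\<And>f. f \<in> F \<Longrightarrow> absolutely_continuous M (\<Gamma> f)"
    and \<Gamma>_triangle: "\<And>f h A. \<lbrakk>f \<in> F; h \<in> F; A \<in> sets M\<rbrakk> \<Longrightarrow>
      measure (\<Gamma> (\<lambda>x. f x + h x)) A powr (1 / p)
        \<le> measure (\<Gamma> f) A powr (1 / p) + measure (\<Gamma> h) A powr (1 / p)"
    and chain_rule: "\<And>f (g :: real \<Rightarrow> real) L. \<lbrakk>f \<in> F; L-lipschitz_on UNIV g; g 0 = 0\<rbrakk> \<Longrightarrow>
      (\<lambda>x. g (f x)) \<in> F \<and>
      measure_le (\<Gamma> (\<lambda>x. g (f x))) (density (\<Gamma> f) (\<lambda>x. ennreal (Lip_a g (f x) powr p)))"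
    and locality: "\<And>f A c. \<lbrakk>f \<in> F; A \<in> sets M; AE x in M. x \<in> A \<longrightarrow> f x = c\<rbrakk> \<Longrightarrow>
      measure (\<Gamma> f) A = 0"
    and lower_semicontinuity: "\<And>f u.
      \<lbrakk>f \<in> Lp_space p M; \<And>i::nat. u i \<in> F;
       (\<lambda>i. Lp_norm p M (\<lambda>x. u i x - f x)) \<longlonglongrightarrow> 0;
       bdd_above (range (\<lambda>i. E (u i)))\<rbrakk> \<Longrightarrow>
      f \<in> F \<and> (\<forall>A\<in>sets M. emeasure (\<Gamma> f) A \<le> liminf (\<lambda>i. emeasure (\<Gamma> (u i)) A))"

end

theory Submission
  imports Defs
begin

text \<open>
  For affine \<open>g\<close> the bound is the triangle inequality for \<open>\<Gamma>\<close>, Cauchy--Schwarz and the power mean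
  inequality. By locality the bound for affine functions of slope at most \<open>L\<close> passes to finite maxima
  and minima. An \<open>L\<close>-Lipschitz \<open>g\<close> is, for any \<open>L' > L\<close>, a pointwise limit of minima of finitely
  many polyhedral cones \<open>g z + L' max\<^sub>v v \<bullet> (y - z)\<close>, where \<open>v\<close> ranges over a fine finite net of the
  unit sphere, so the bound with the global constant follows from lower semicontinuity. To
  replace the global constant by the pointwise one, \<open>g\<close> is replaced on small balls by a Lipschitz extension
  of its restriction, again using locality, and the level sets of the pointwise constant are summed.
\<close>

section \<open>Power means and Cauchy--Schwarz\<close>

text \<open>Normalising by the total settles \<open>q \<le> 1\<close> with constant 1, and Jensen's
  inequality settles \<open>q > 1\<close> with the power of the cardinality; the maximum covers both
  cases.\<close>

lemma sum_powr_le_max: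
  fixes y :: "'i \<Rightarrow> real"
  assumes "finite I" and nonneg: "\<And>i. i \<in> I \<Longrightarrow> 0 \<le> y i" and "0 < q"
  shows "(\<Sum>i\<in>I. y i) powr q \<le> max 1 (real (card I) powr (q - 1)) * (\<Sum>i\<in>I. y i powr q)"
proof -
  \<comment> \<open>Zero entries contribute to neither sum; discarding them leaves strictly positive
    terms for the normalisation and for convexity.\<close>
  define J where "J = {i \<in> I. 0 < y i}"
  have J: "finite J" "J \<subseteq> I" "\<And>i. i \<in> J \<Longrightarrow> 0 < y i"
    using assms by (auto simp: J_def)
  have sums: "(\<Sum>i\<in>I. y i) = (\<Sum>i\<in>J. y i)" "(\<Sum>i\<in>I. y i powr q) = (\<Sum>i\<in>J. y i powr q)"
    using \<open>finite I\<close> nonneg by (force intro!: sum.mono_neutral_right simp: J_def)+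
  show ?thesis
  proof (cases "J = {}")
    case False
    define S where "S = (\<Sum>i\<in>J. y i)"
    have S: "0 < S"
      unfolding S_def using J False by (intro sum_pos) auto
    have k: "0 < real (card J)"
      using False J by (simp add: card_gt_0_iff)
    have T: "0 \<le> (\<Sum>i\<in>J. y i powr q)"
      by (intro sum_nonneg) auto
    show ?thesis
    proof (cases "q \<le> 1")
      case True
      have "y i / S \<le> (y i / S) powr q" if "i \<in> J" for i
      proof -
        have "y i \<le> S"
          unfolding S_def using J that by (intro member_le_sum) (auto intro: less_imp_le)
        then have "0 < y i / S" "y i / S \<le> 1"
          using S J that by auto
        then have "(y i / S) powr 1 \<le> (y i / S) powr q"
          using True by (intro powr_mono') auto
        then show ?thesis
          unfolding powr_one[OF less_imp_le[OF \<open>0 < y i / S\<close>]] .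
      qed
      then have "(\<Sum>i\<in>J. y i / S) \<le> (\<Sum>i\<in>J. (y i / S) powr q)"
        by (intro sum_mono)
      also have "\<dots> = (\<Sum>i\<in>J. y i powr q / S powr q)"
        using S J by (intro sum.cong) (auto simp: powr_divide intro: less_imp_le)
      finally have "(\<Sum>i\<in>J. y i) / S \<le> (\<Sum>i\<in>J. y i powr q) / S powr q"
        by (simp add: sum_divide_distrib)
      then have "S powr q \<le> (\<Sum>i\<in>J. y i powr q)"
        using S by (simp add: S_def[symmetric] field_simps)
      also have "\<dots> \<le> max 1 (real (card I) powr (q - 1)) * (\<Sum>i\<in>J. y i powr q)"
        using T by (simp add: mult_le_cancel_right1)
      finally show ?thesis by (simp add: sums S_def)
    next
      case False
      \<comment> \<open>Jensen with equal weights; clearing denominators leaves the factor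
        \<open>real (card J) powr (q - 1)\<close>.\<close>
      have "(\<Sum>i\<in>J. (1 / real (card J)) *\<^sub>R y i) powr q
          \<le> (\<Sum>i\<in>J. 1 / real (card J) * y i powr q)"
        using J k False \<open>J \<noteq> {}\<close>
        by (intro convex_on_sum[OF _ _ powr_convex]) auto
      then have "(S / real (card J)) powr q \<le> (\<Sum>i\<in>J. y i powr q) / real (card J)"
        by (simp add: S_def sum_divide_distrib)
      then have "S powr q / real (card J) powr q \<le> (\<Sum>i\<in>J. y i powr q) / real (card J)"
        using S k by (simp add: powr_divide)
      then have "S powr q \<le> real (card J) powr (q - 1) * (\<Sum>i\<in>J. y i powr q)"
        using k by (simp add: powr_diff field_simps)
      also have "\<dots> \<le> max 1 (real (card I) powr (q - 1)) * (\<Sum>i\<in>J. y i powr q)"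
        using T False J assms card_mono[of I J]
        by (intro mult_right_mono max.coboundedI2 powr_mono2) auto
      finally show ?thesis by (simp add: sums S_def)
    qed
  qed (simp add: sums)
qed

text \<open>Cauchy--Schwarz splits off the Euclidean norm of \<open>a\<close>. The remaining sum of
  squares is raised to the power \<open>q = p / 2\<close>, so \<open>sum_powr_le_max\<close> applies
  to the squares, and \<open>q - 1 = (p - 2) / 2\<close> produces the constant of the
  theorem.\<close>

lemma powr_sum_abs_mult_le:
  fixes a :: "real ^ 'n" and x :: "'n \<Rightarrow> real"
  assumes "0 < p" and "\<And>i. 0 \<le> x i"
  shows "(\<Sum>i\<in>UNIV. \<bar>a $ i\<bar> * x i) powr p
    \<le> max 1 (real CARD('n) powr ((p - 2) / 2)) * norm a powr p * (\<Sum>i\<in>UNIV. x i powr p)"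
proof -
  have "(\<Sum>i\<in>UNIV. \<bar>a $ i\<bar> * x i) \<le> L2_set (($) a) UNIV * L2_set x UNIV"
    using L2_set_mult_ineq[of "($) a" x UNIV] assms by simp
  then have "(\<Sum>i\<in>UNIV. \<bar>a $ i\<bar> * x i) powr p \<le> (norm a * L2_set x UNIV) powr p"
    using assms by (intro powr_mono2) (auto simp: norm_vec_def L2_set_def intro!: sum_nonneg)
  also have "\<dots> = norm a powr p * (\<Sum>i\<in>UNIV. (x i)\<^sup>2) powr (p / 2)"
    by (simp add: powr_mult L2_set_def powr_half_sqrt[symmetric] sum_nonneg powr_powr)
  also have "\<dots> \<le> norm a powr p *
      (max 1 (real CARD('n) powr (p / 2 - 1)) * (\<Sum>i\<in>UNIV. (x i)\<^sup>2 powr (p / 2)))"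
    using assms by (intro mult_left_mono sum_powr_le_max) auto
  also have "(\<Sum>i\<in>UNIV. (x i)\<^sup>2 powr (p / 2)) = (\<Sum>i\<in>UNIV. x i powr p)"
  proof (intro sum.cong refl)
    fix i show "(x i)\<^sup>2 powr (p / 2) = x i powr p"
      using assms(2)[of i] by (cases "x i = 0") (auto simp: powr_powr simp flip: powr_numeral)
  qed
  finally show ?thesis
    by (simp add: diff_divide_distrib mult_ac)
qed

section \<open>Lipschitz extension and the asymptotic Lipschitz constant\<close>

text \<open>McShane's extension: an infimum of cones of slope \<open>L\<close> with vertices on the
  graph of \<open>g\<close>. It keeps the constant, which matters when \<open>g\<close> is later
  replaced locally by an extension.\<close>

lemma lipschitz_extension:
  fixes g :: "'b::metric_space \<Rightarrow> real"
  assumes "L-lipschitz_on S g" and "S \<noteq> {}"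
  obtains h where "L-lipschitz_on UNIV h" and "\<And>y. y \<in> S \<Longrightarrow> h y = g y"
proof -
  define h where "h y = (INF z\<in>S. g z + L * dist y z)" for y
  have L: "0 \<le> L"
    using assms(1) by (rule lipschitz_on_nonneg)
  have g: "g x \<le> g z + L * dist x z" if "x \<in> S" "z \<in> S" for x z
    using lipschitz_onD[OF assms(1) that] by (simp add: dist_real_def)
  obtain z0 where z0: "z0 \<in> S"
    using assms by auto
  \<comment> \<open>The infimum is finite: every cone lies above the downward cone at the fixed
    point \<open>z0\<close>.\<close>
  have bdd: "bdd_below ((\<lambda>z. g z + L * dist y z) ` S)" for y
  proof (rule bdd_belowI2)
    fix z assume "z \<in> S"
    have "L * dist z0 z \<le> L * (dist y z0 + dist y z)"
      using L by (intro mult_left_mono) (metis dist_triangle2 dist_commute)+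
    with g[OF z0 \<open>z \<in> S\<close>] show "g z0 - L * dist y z0 \<le> g z + L * dist y z"
      by (simp add: algebra_simps)
  qed
  have le: "h x \<le> h y + L * dist x y" for x y
  proof -
    have "h x - L * dist x y \<le> h y"
      unfolding h_def[of y]
    proof (rule cINF_greatest)
      fix z assume z: "z \<in> S"
      have "h x \<le> g z + L * dist x z"
        unfolding h_def using bdd z by (rule cINF_lower)
      also have "\<dots> \<le> g z + L * (dist x y + dist y z)"
        using L by (intro add_left_mono mult_left_mono dist_triangle)
      finally show "h x - L * dist x y \<le> g z + L * dist y z"
        by (simp add: algebra_simps)
    qed fact
    then show ?thesis by simp
  qed
  show thesis
  proof
    show "L-lipschitz_on UNIV h"
    proof (rule lipschitz_onI)
      fix x y show "dist (h x) (h y) \<le> L * dist x y"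
        using le[of x y] le[of y x] by (simp add: dist_real_def dist_commute abs_le_iff)
    qed fact
    show "h y = g y" if "y \<in> S" for y
    proof (rule antisym)
      show "h y \<le> g y"
        using cINF_lower[OF bdd[of y] that] by (simp add: h_def)
      show "g y \<le> h y"
        unfolding h_def using assms g[OF that] by (intro cINF_greatest) auto
    qed
  qed
qed

lemma LIP_le: "L-lipschitz_on S g \<Longrightarrow> LIP g S \<le> L"
  unfolding LIP_def by (rule cInf_lower) (auto intro!: bdd_belowI[of _ 0] lipschitz_on_nonneg)

lemma LIP_nonneg:
  assumes "L-lipschitz_on S g"
  shows "0 \<le> LIP g S"
  unfolding LIP_def using assms by (intro cInf_greatest) (auto intro: lipschitz_on_nonneg)

lemma LIP_less_imp_lipschitz_on:
  assumes "L-lipschitz_on S g" and "LIP g S < c"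
  obtains c' where "c' < c" and "c'-lipschitz_on S g"
  using cInf_lessD[of "{L. L-lipschitz_on S g}" c] assms unfolding LIP_def by auto

text \<open>Since \<open>Lip_a\<close> is defined through \<open>Lim\<close>, convergence has to be
  established before its value can be used. The constants on balls are monotone in the radius and
  nonnegative, so the limit is their infimum.\<close>

lemma tendsto_Lip_a:
  fixes g :: "'b::metric_space \<Rightarrow> real"
  assumes "L-lipschitz_on UNIV g"
  shows "((\<lambda>r. LIP g (ball y r)) \<longlongrightarrow> Lip_a g y) (at_right 0)"
proof -
  have lip: "L-lipschitz_on S g" for S
    using assms by (rule lipschitz_on_subset) simp
  define l where "l = (INF r\<in>{0<..}. LIP g (ball y r))"
  have bdd: "bdd_below ((\<lambda>r. LIP g (ball y r)) ` {0<..})"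
    using LIP_nonneg[OF lip] by (intro bdd_belowI2)
  have mono: "LIP g (ball y r) \<le> LIP g (ball y s)" if "r \<le> s" for r s
    unfolding LIP_def using lip that
    by (intro cInf_superset_mono)
      (auto intro!: bdd_belowI[of _ 0] lipschitz_on_nonneg elim: lipschitz_on_subset)
  have "((\<lambda>r. LIP g (ball y r)) \<longlongrightarrow> l) (at_right 0)"
  proof (rule order_tendstoI)
    fix a assume "a < l"
    have "l \<le> LIP g (ball y r)" if "0 < r" for r
      unfolding l_def using that by (intro cINF_lower[OF bdd]) auto
    with \<open>a < l\<close> show "\<forall>\<^sub>F r in at_right 0. a < LIP g (ball y r)"
      unfolding eventually_at_right_field by (intro exI[of _ 1]) force
  next
    fix a assume "l < a"
    then obtain s where "0 < s" "LIP g (ball y s) < a"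
      unfolding l_def by (subst (asm) cINF_less_iff[OF _ bdd]) auto
    then show "\<forall>\<^sub>F r in at_right 0. LIP g (ball y r) < a"
      unfolding eventually_at_right_field using mono
      by (intro exI[of _ s]) (auto intro: le_less_trans less_imp_le)
  qed
  then show ?thesis
    unfolding Lip_a_def by (simp add: tendsto_Lim)
qed

lemma Lip_a_nonneg:
  fixes g :: "'b::metric_space \<Rightarrow> real"
  assumes "L-lipschitz_on UNIV g"
  shows "0 \<le> Lip_a g y"
  using tendsto_Lip_a[OF assms]
  by (rule tendsto_lowerbound) (auto intro!: always_eventually LIP_nonneg lipschitz_on_subset[OF assms])

lemma Lip_a_le:
  fixes g :: "'b::metric_space \<Rightarrow> real"
  assumes "L-lipschitz_on UNIV g" and "c-lipschitz_on (ball y r) g" and "0 < r"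
  shows "Lip_a g y \<le> c"
proof (rule tendsto_upperbound[OF tendsto_Lip_a[OF assms(1)]])
  show "\<forall>\<^sub>F s in at_right 0. LIP g (ball y s) \<le> c"
    unfolding eventually_at_right_field using \<open>0 < r\<close>
    by (intro exI[of _ r]) (auto intro!: LIP_le lipschitz_on_subset[OF assms(2)])
qed simp

text \<open>The constant \<open>c'\<close> stays strictly below \<open>c\<close>; this margin is the
  one that \<open>dominated_lipschitz\<close> asks for.\<close>

lemma Lip_a_less_imp_lipschitz_on_ball:
  fixes g :: "'b::metric_space \<Rightarrow> real"
  assumes "L-lipschitz_on UNIV g" and "Lip_a g y < c"
  obtains r c' where "0 < r" and "c' < c" and "c'-lipschitz_on (ball y r) g"
proof -
  have "\<forall>\<^sub>F r in at_right 0. LIP g (ball y r) < c"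
    using order_tendstoD(2)[OF tendsto_Lip_a[OF assms(1)] assms(2)] .
  then obtain b :: real where b: "0 < b" "\<And>r. 0 < r \<Longrightarrow> r < b \<Longrightarrow> LIP g (ball y r) < c"
    unfolding eventually_at_right_field by auto
  then have "LIP g (ball y (b / 2)) < c"
    by simp
  moreover have "L-lipschitz_on (ball y (b / 2)) g"
    using assms(1) by (rule lipschitz_on_subset) simp
  ultimately show thesis
    using that[of "b / 2"] b LIP_less_imp_lipschitz_on by (metis half_gt_zero)
qed

text \<open>Upper semicontinuity: a constant \<open>c' < c\<close> valid on a ball bounds
  \<open>Lip_a\<close> at every point of that ball, so strict sublevel sets are open.\<close>

lemma borel_measurable_Lip_a:
  fixes g :: "'b::metric_space \<Rightarrow> real"
  assumes "L-lipschitz_on UNIV g"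
  shows "Lip_a g \<in> borel_measurable borel"
proof (rule borel_measurableI_less)
  fix c
  have "\<exists>r>0. ball y r \<subseteq> {y. Lip_a g y < c}" if c: "Lip_a g y < c" for y
  proof -
    obtain r c' where r: "0 < r" "c' < c" "c'-lipschitz_on (ball y r) g"
      using Lip_a_less_imp_lipschitz_on_ball[OF assms c] .
    have "Lip_a g z < c" if z: "z \<in> ball y r" for z
    proof -
      obtain s where "0 < s" "ball z s \<subseteq> ball y r"
        using openE[OF open_ball z] by blast
      then have "Lip_a g z \<le> c'"
        using Lip_a_le[OF assms] lipschitz_on_subset[OF r(3)] by blast
      with r show ?thesis by simp
    qed
    with r show ?thesis by auto
  qed
  then have "open {y. Lip_a g y < c}"
    unfolding open_contains_ball by auto
  then show "{y \<in> space borel. Lip_a g y < c} \<in> sets borel"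
    by simp
qed

section \<open>Finite nets of directions\<close>

text \<open>Replacing the direction of \<open>w\<close> by a nearby net point loses a factor, which
  the gap between \<open>L\<close> and \<open>L'\<close> absorbs. This is what makes polyhedral
  cones possible.\<close>

lemma finite_directions_norming:
  fixes L L' :: real
  assumes "0 \<le> L" and "L < L'"
  obtains V :: "'b::euclidean_space set" where "finite V" and "V \<noteq> {}"
    and "\<And>v. v \<in> V \<Longrightarrow> norm v \<le> 1"
    and "\<And>w. \<exists>v\<in>V. L * norm w \<le> L' * (v \<bullet> w)"
proof -
  \<comment> \<open>The mesh is chosen so that \<open>L' * (1 - d) = L\<close>.\<close>
  define d where "d = (L' - L) / L'"
  have d: "0 < d"
    using assms by (simp add: d_def)
  obtain K where K: "finite K" "K \<subseteq> sphere (0::'b) 1" "sphere (0::'b) 1 \<subseteq> (\<Union>x\<in>K. ball x d)"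
    using compactE_image[OF compact_sphere, of "sphere (0::'b) 1" "\<lambda>x. ball x d"] d
    by (metis (no_types, lifting) UN_iff centre_in_ball open_ball subsetI)
  \<comment> \<open>Inserting 0 makes the net visibly nonempty and supplies the witness for
    \<open>w = 0\<close>.\<close>
  have "\<exists>v\<in>insert 0 K. L * norm w \<le> L' * (v \<bullet> w)" for w
  proof (cases "w = 0")
    case False
    define u where "u = w /\<^sub>R norm w"
    have "u \<in> sphere 0 1"
      using False by (simp add: u_def)
    then obtain v where v: "v \<in> K" "dist v u < d"
      using K by auto
    have "(u - v) \<bullet> u \<le> norm (u - v) * norm u"
      by (rule norm_cauchy_schwarz)
    also have "\<dots> \<le> d"
      using v \<open>u \<in> sphere 0 1\<close> by (simp add: dist_norm norm_minus_commute)
    finally have "1 - d \<le> v \<bullet> u"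
      using \<open>u \<in> sphere 0 1\<close> by (simp add: inner_diff_left dot_square_norm)
    then have "L' * (1 - d) * norm w \<le> L' * (v \<bullet> u) * norm w"
      using assms by (intro mult_right_mono mult_left_mono) auto
    moreover have "L' * (1 - d) = L"
      using assms by (simp add: d_def field_simps)
    moreover have "(v \<bullet> u) * norm w = v \<bullet> w"
      using False by (simp add: u_def)
    ultimately have "L * norm w \<le> L' * (v \<bullet> w)"
      by (simp add: mult.assoc)
    with v show ?thesis by auto
  qed auto
  moreover have "norm v \<le> 1" if "v \<in> insert 0 K" for v
    using that K by auto
  ultimately show thesis
    using that[of "insert 0 K"] K by blast
qed

section \<open>Comparison and sums of measures\<close>

text \<open>Disjointing the cover splits \<open>A\<close> into countably many pieces, each inside
  one member, and countable additivity adds up the estimates. The local hypothesis ranges over all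
  measurable subsets because the pieces may be smaller than the members.\<close>

lemma emeasure_le_of_countable_cover:
  assumes sets: "sets N' = sets N" and A: "A \<in> sets N" and "countable \<B>"
    and \<B>: "\<And>B. B \<in> \<B> \<Longrightarrow> B \<in> sets N" "A \<subseteq> \<Union>\<B>"
    and le: "\<And>B C. \<lbrakk>B \<in> \<B>; C \<in> sets N; C \<subseteq> A \<inter> B\<rbrakk> \<Longrightarrow> emeasure N C \<le> emeasure N' C"
  shows "emeasure N A \<le> emeasure N' A"
proof (cases "\<B> = {}")
  case False
  \<comment> \<open>For a finite cover \<open>from_nat_into\<close> repeats members; the repetitions
    become empty after disjointing.\<close>
  define D where "D i = A \<inter> disjointed (from_nat_into \<B>) i" for i
  have mem: "from_nat_into \<B> i \<in> \<B>" for i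
    using False by (rule from_nat_into)
  have D: "D i \<in> sets N" for i
    using A \<B> mem sets.range_disjointed_sets[of "from_nat_into \<B>" N] by (auto simp: D_def)
  have disj: "disjoint_family D"
    using disjoint_family_disjointed[of "from_nat_into \<B>"]
    by (auto simp: D_def disjoint_family_on_def)
  have A_eq: "A = (\<Union>i. D i)"
    using \<B>(2)
    by (simp add: D_def UN_disjointed_eq range_from_nat_into[OF False \<open>countable \<B>\<close>] Int_absorb2
        flip: Int_UN_distrib)
  have "emeasure N A = (\<Sum>i. emeasure N (D i))"
    unfolding A_eq using D disj by (intro suminf_emeasure[symmetric]) auto
  also have "\<dots> \<le> (\<Sum>i. emeasure N' (D i))"
  proof (intro suminf_le)
    fix i
    have "D i \<subseteq> A \<inter> from_nat_into \<B> i"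
      using disjointed_subset[of "from_nat_into \<B>" i] by (auto simp: D_def)
    then show "emeasure N (D i) \<le> emeasure N' (D i)"
      using le[OF mem D] by blast
  qed auto
  also have "\<dots> = emeasure N' A"
    unfolding A_eq using D disj sets by (intro suminf_emeasure) auto
  finally show ?thesis .
qed (use \<B> in auto)

lemma sets_sum_measure [simp]: "sets (sum_measure M I N) = sets M"
  and space_sum_measure [simp]: "space (sum_measure M I N) = space M"
  by (auto simp: sum_measure_def)

text \<open>The values prescribed in \<open>measure_of\<close> are attained only for a countably
  additive set function; additivity follows by interchanging the finite sum with the series.\<close>

lemma emeasure_sum_measure:
  fixes M :: "'a measure"
  assumes "finite I" and "\<And>i. i \<in> I \<Longrightarrow> sets (N i) = sets M" and "A \<in> sets M"
  shows "emeasure (sum_measure M I N) A = (\<Sum>i\<in>I. emeasure (N i) A)"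
proof -
  have "countably_additive (sets M) (\<lambda>A. \<Sum>i\<in>I. emeasure (N i) A)"
  proof (rule countably_additiveI)
    fix B :: "nat \<Rightarrow> 'a set" assume "range B \<subseteq> sets M" "disjoint_family B"
    then have "(\<Sum>i\<in>I. emeasure (N i) (\<Union>k. B k)) = (\<Sum>i\<in>I. \<Sum>k. emeasure (N i) (B k))"
      using assms by (intro sum.cong refl suminf_emeasure[symmetric]) auto
    also have "\<dots> = (\<Sum>k. \<Sum>i\<in>I. emeasure (N i) (B k))"
      by (intro suminf_sum[symmetric]) auto
    finally show "(\<Sum>k. \<Sum>i\<in>I. emeasure (N i) (B k)) = (\<Sum>i\<in>I. emeasure (N i) (\<Union>k. B k))"
      by simp
  qed
  then show ?thesis
    unfolding sum_measure_def using assms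
    by (intro emeasure_measure_of_sigma) (auto simp: positive_def sets.sigma_algebra_axioms)
qed

section \<open>Lattice operations and locality in a Dirichlet structure\<close>

context p_dirichlet_structure
begin

lemma F_measurable: "u \<in> F \<Longrightarrow> u \<in> borel_measurable M"
  using F_subset_Lp by (auto simp: Lp_space_def)

lemma F_const: "(\<lambda>x. c) \<in> F"
  using F_scale[OF F_one, of c] by simp

lemma F_diff: "u \<in> F \<Longrightarrow> v \<in> F \<Longrightarrow> (\<lambda>x. u x - v x) \<in> F"
  using F_add[of u "\<lambda>x. - 1 * v x"] F_scale[of v "- 1"] by simp

lemma F_sum: "finite I \<Longrightarrow> (\<And>i. i \<in> I \<Longrightarrow> u i \<in> F) \<Longrightarrow> (\<lambda>x. \<Sum>i\<in>I. u i x) \<in> F"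
  by (induction I rule: finite_induct) (auto intro: F_zero F_add)

text \<open>Write the maximum as \<open>u x + max 0 (v x - u x)\<close> and apply the one-variable
  chain rule to the 1-Lipschitz map \<open>max 0\<close>.\<close>

lemma F_max:
  assumes "u \<in> F" and "v \<in> F"
  shows "(\<lambda>x. max (u x) (v x)) \<in> F"
proof -
  have "1-lipschitz_on UNIV (max (0::real))"
    by (rule lipschitz_onI) (auto simp: dist_real_def)
  then have "(\<lambda>x. max 0 (v x - u x)) \<in> F"
    using chain_rule[OF F_diff[OF assms(2,1)], of 1 "max 0"] by simp
  then have "(\<lambda>x. u x + max 0 (v x - u x)) \<in> F"
    by (rule F_add[OF assms(1)])
  moreover have "u x + max 0 (v x - u x) = max (u x) (v x)" for x
    by simp
  ultimately show ?thesis by simp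
qed

lemma F_abs:
  assumes "u \<in> F"
  shows "(\<lambda>x. \<bar>u x\<bar>) \<in> F"
proof -
  have "(\<lambda>x. max (u x) (- 1 * u x)) \<in> F"
    using assms by (intro F_max F_scale)
  moreover have "max (u x) (- 1 * u x) = \<bar>u x\<bar>" for x
    by simp
  ultimately show ?thesis by simp
qed

lemma emeasure_\<Gamma>: "u \<in> F \<Longrightarrow> emeasure (\<Gamma> u) A = ennreal (measure (\<Gamma> u) A)"
  by (simp add: \<Gamma>_finite finite_measure.emeasure_eq_measure)

text \<open>The working form of locality: in \<open>u = v + (u - v)\<close> the difference has no
  energy on \<open>A\<close>, so the triangle inequality for \<open>\<Gamma>\<close> leaves only the
  term of \<open>v\<close>. Every later replacement of one function by another on a set goes through
  this bound.\<close>

lemma emeasure_\<Gamma>_le_of_diff_const: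
  assumes p: "0 < p" and u: "u \<in> F" and v: "v \<in> F" and A: "A \<in> sets M"
    and eq: "\<And>x. x \<in> A \<Longrightarrow> u x - v x = c"
  shows "emeasure (\<Gamma> u) A \<le> emeasure (\<Gamma> v) A"
proof -
  let ?w = "\<lambda>x. u x - v x"
  have w: "?w \<in> F"
    using u v by (rule F_diff)
  have "measure (\<Gamma> ?w) A = 0"
    using w A eq by (intro locality[of _ _ c]) auto
  then have "measure (\<Gamma> u) A powr (1 / p) \<le> measure (\<Gamma> v) A powr (1 / p)"
    using \<Gamma>_triangle[OF v w A] by simp
  then have "measure (\<Gamma> u) A \<le> measure (\<Gamma> v) A"
    using p powr_less_mono2[of "1 / p" "measure (\<Gamma> v) A" "measure (\<Gamma> u) A"]
    by (auto simp: not_less[symmetric])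
  then show ?thesis
    using u v by (simp add: emeasure_\<Gamma> ennreal_leI)
qed

lemma measure_\<Gamma>_sum_le:
  assumes "finite I" and "\<And>i. i \<in> I \<Longrightarrow> u i \<in> F" and "A \<in> sets M" and p: "0 < p"
  shows "measure (\<Gamma> (\<lambda>x. \<Sum>i\<in>I. a i * u i x)) A powr (1 / p)
    \<le> (\<Sum>i\<in>I. \<bar>a i\<bar> * measure (\<Gamma> (u i)) A powr (1 / p))"
  using assms(1,2)
proof (induction I rule: finite_induct)
  case empty
  \<comment> \<open>The zero function is constant, so locality makes its energy vanish on
    \<open>A\<close>.\<close>
  have "measure (\<Gamma> (\<lambda>x. 0)) A = 0"
    using F_zero assms by (intro locality[of _ _ 0]) auto
  then show ?case by simp
next
  case (insert i I)
  have "measure (\<Gamma> (\<lambda>x. a i * u i x)) A = \<bar>a i\<bar> powr p * measure (\<Gamma> (u i)) A"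
    using insert by (simp add: \<Gamma>_scale)
  then have "measure (\<Gamma> (\<lambda>x. a i * u i x)) A powr (1 / p)
      = \<bar>a i\<bar> * measure (\<Gamma> (u i)) A powr (1 / p)"
    using p by (simp add: powr_mult powr_powr)
  moreover have "measure (\<Gamma> (\<lambda>x. a i * u i x + (\<Sum>i\<in>I. a i * u i x))) A powr (1 / p)
      \<le> measure (\<Gamma> (\<lambda>x. a i * u i x)) A powr (1 / p)
        + measure (\<Gamma> (\<lambda>x. \<Sum>i\<in>I. a i * u i x)) A powr (1 / p)"
    using insert assms(3) by (intro \<Gamma>_triangle F_scale F_sum) auto
  ultimately show ?case
    using insert by simp
qed

end

section \<open>Functions with energy dominated by the sum measure\<close>

locale p_dirichlet_tuple = p_dirichlet_structure p M E F \<Gamma>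
  for p :: real and M :: "'a measure" and E F \<Gamma> +
  fixes f :: "'n::finite \<Rightarrow> 'a \<Rightarrow> real"
  assumes p_gt_1: "1 < p" and f_in_F: "\<And>i. f i \<in> F"
begin

definition \<sigma> :: "'a measure" where
  "\<sigma> = sum_measure M UNIV (\<lambda>i. \<Gamma> (f i))"

definition C :: real where
  "C = max 1 (real CARD('n) powr ((p - 2) / 2))"

definition fvec :: "'a \<Rightarrow> real ^ 'n" where
  "fvec x = (\<chi> i. f i x)"

text \<open>Membership in \<open>F\<close> and the setwise bound are kept together because both must
  pass through maxima, minima and limits, with the same \<open>K\<close> throughout.\<close>

definition dominated :: "real \<Rightarrow> ('a \<Rightarrow> real) \<Rightarrow> bool" where
  "dominated K u \<longleftrightarrow>
    u \<in> F \<and> (\<forall>A\<in>sets M. emeasure (\<Gamma> u) A \<le> ennreal K * emeasure \<sigma> A)"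

lemma p_pos: "0 < p"
  using p_gt_1 by simp

lemma C_ge_1: "1 \<le> C"
  by (simp add: C_def)

lemma fvec_measurable [measurable]: "fvec \<in> borel_measurable M"
  unfolding fvec_def borel_measurable_euclidean_space[of "\<lambda>x. \<chi> i. f i x"]
  using F_measurable[OF f_in_F] by (auto simp: Basis_vec_def inner_axis)

lemma sets_\<sigma> [simp, measurable_cong]: "sets \<sigma> = sets M"
  and space_\<sigma> [simp]: "space \<sigma> = space M"
  by (simp_all add: \<sigma>_def)

lemma emeasure_\<sigma>:
  assumes "A \<in> sets M"
  shows "emeasure \<sigma> A = ennreal (\<Sum>i\<in>UNIV. measure (\<Gamma> (f i)) A)"
  using assms unfolding \<sigma>_def
  by (subst emeasure_sum_measure) (auto simp: \<Gamma>_sets f_in_F emeasure_\<Gamma> sum_ennreal)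

text \<open>The factor \<open>C\<close> arises here: subadditivity bounds the root of the energy by
  a weighted sum of roots, and \<open>powr_sum_abs_mult_le\<close> turns this into a multiple of
  \<open>\<sigma>\<close>. Later estimates keep \<open>C\<close> and change only the slope
  bound.\<close>

lemma dominated_affine:
  assumes "norm a \<le> L"
  shows "dominated (C * L powr p) (\<lambda>x. c + a \<bullet> fvec x)"
proof -
  let ?l = "\<lambda>x. \<Sum>i\<in>UNIV. a $ i * f i x"
  have l: "?l \<in> F"
    using f_in_F by (intro F_sum F_scale) auto
  have eq: "c + a \<bullet> fvec x = c + ?l x" for x
    by (simp add: inner_vec_def fvec_def)
  have cl: "(\<lambda>x. c + ?l x) \<in> F"
    by (intro F_add F_const l)
  have "emeasure (\<Gamma> (\<lambda>x. c + ?l x)) A \<le> ennreal (C * L powr p) * emeasure \<sigma> A"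
    if A: "A \<in> sets M" for A
  proof -
    \<comment> \<open>The triangle inequality holds for \<open>p\<close>-th roots of
      energies.\<close>
    define m where "m i = measure (\<Gamma> (f i)) A powr (1 / p)" for i
    have m: "0 \<le> m i" "m i powr p = measure (\<Gamma> (f i)) A" for i
      using p_pos by (auto simp: m_def powr_powr)
    have "measure (\<Gamma> ?l) A powr (1 / p) \<le> (\<Sum>i\<in>UNIV. \<bar>a $ i\<bar> * m i)"
      unfolding m_def using A f_in_F p_pos by (intro measure_\<Gamma>_sum_le) auto
    then have "(measure (\<Gamma> ?l) A powr (1 / p)) powr p \<le> (\<Sum>i\<in>UNIV. \<bar>a $ i\<bar> * m i) powr p"
      using p_pos by (intro powr_mono2) auto
    then have "measure (\<Gamma> ?l) A \<le> (\<Sum>i\<in>UNIV. \<bar>a $ i\<bar> * m i) powr p"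
      using p_pos by (simp add: powr_powr)
    also have "\<dots> \<le> C * norm a powr p * (\<Sum>i\<in>UNIV. measure (\<Gamma> (f i)) A)"
      using powr_sum_abs_mult_le[OF p_pos m(1), of a] by (simp add: C_def m)
    also have "\<dots> \<le> C * L powr p * (\<Sum>i\<in>UNIV. measure (\<Gamma> (f i)) A)"
      using assms C_ge_1 p_pos
      by (intro mult_right_mono mult_left_mono powr_mono2 sum_nonneg) auto
    finally have "emeasure (\<Gamma> ?l) A
        \<le> ennreal (C * L powr p * (\<Sum>i\<in>UNIV. measure (\<Gamma> (f i)) A))"
      by (simp add: emeasure_\<Gamma>[OF l] ennreal_leI)
    also have "\<dots> = ennreal (C * L powr p) * emeasure \<sigma> A"
      using A C_ge_1 by (simp add: emeasure_\<sigma> ennreal_mult sum_nonneg)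
    \<comment> \<open>Restoring \<open>c\<close> costs nothing, since the two functions differ by a
      constant.\<close>
    finally show ?thesis
      using emeasure_\<Gamma>_le_of_diff_const[OF p_pos cl l A, of c] by simp
  qed
  with cl show ?thesis
    by (simp add: dominated_def eq)
qed

text \<open>On \<open>{v \<le> u}\<close> the maximum is \<open>u\<close>, on the complement it is
  \<open>v\<close>, and locality compares the energies. As \<open>A\<close> is split along these two
  sets, the constant remains \<open>K\<close> instead of doubling.\<close>

lemma dominated_max:
  assumes "dominated K u" and "dominated K v"
  shows "dominated K (\<lambda>x. max (u x) (v x))"
proof -
  let ?w = "\<lambda>x. max (u x) (v x)"
  have F: "u \<in> F" "v \<in> F" "?w \<in> F"
    using assms F_max by (auto simp: dominated_def)
  have [measurable]: "u \<in> borel_measurable M" "v \<in> borel_measurable M"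
    using F by (auto intro: F_measurable)
  \<comment> \<open>The bound is phrased as a measure so that the covering lemma applies.\<close>
  have "emeasure (\<Gamma> ?w) A \<le> emeasure (scale_measure (ennreal K) \<sigma>) A" if "A \<in> sets M" for A
  proof (rule emeasure_le_of_countable_cover
      [where \<B> = "{{x\<in>space M. v x \<le> u x}, {x\<in>space M. u x < v x}}"])
    fix B D
    assume B: "B \<in> {{x\<in>space M. v x \<le> u x}, {x\<in>space M. u x < v x}}"
      and D: "D \<in> sets (\<Gamma> ?w)" "D \<subseteq> A \<inter> B"
    have "D \<in> sets M"
      using D F by (simp add: \<Gamma>_sets)
    have "emeasure (\<Gamma> ?w) D \<le> emeasure (\<Gamma> u) D \<or> emeasure (\<Gamma> ?w) D \<le> emeasure (\<Gamma> v) D"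
    proof (cases "B = {x\<in>space M. v x \<le> u x}")
      case True
      with D F \<open>D \<in> sets M\<close> show ?thesis
        by (intro disjI1 emeasure_\<Gamma>_le_of_diff_const[where c = 0] p_pos) auto
    next
      case False
      with B D F \<open>D \<in> sets M\<close> show ?thesis
        by (intro disjI2 emeasure_\<Gamma>_le_of_diff_const[where c = 0] p_pos) auto
    qed
    then show "emeasure (\<Gamma> ?w) D \<le> emeasure (scale_measure (ennreal K) \<sigma>) D"
      using assms \<open>D \<in> sets M\<close> by (auto simp: dominated_def intro: order_trans)
  next
    show "A \<subseteq> \<Union> {{x\<in>space M. v x \<le> u x}, {x\<in>space M. u x < v x}}"
      using sets.sets_into_space[OF that] by auto
  qed (use that F in \<open>auto simp: \<Gamma>_sets\<close>)
  with F show ?thesis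
    by (simp add: dominated_def)
qed

lemma dominated_uminus:
  assumes "dominated K u"
  shows "dominated K (\<lambda>x. - u x)"
proof -
  have u: "u \<in> F"
    using assms by (simp add: dominated_def)
  have "(\<lambda>x. - u x) \<in> F"
    using F_scale[OF u, of "- 1"] by simp
  moreover have "emeasure (\<Gamma> (\<lambda>x. - u x)) A = emeasure (\<Gamma> u) A" for A
    using arg_cong[OF \<Gamma>_scale[OF u, of "- 1"], of "\<lambda>N. emeasure N A"] by simp
  ultimately show ?thesis
    using assms by (simp add: dominated_def)
qed

lemma dominated_min:
  assumes "dominated K u" and "dominated K v"
  shows "dominated K (\<lambda>x. min (u x) (v x))"
  using dominated_uminus[OF dominated_max[OF assms[THEN dominated_uminus]]]
  by (simp add: minus_max_eq_min)

lemma dominated_Max: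
  assumes "finite I" and "I \<noteq> {}" and "\<And>i. i \<in> I \<Longrightarrow> dominated K (u i)"
  shows "dominated K (\<lambda>x. Max ((\<lambda>i. u i x) ` I))"
  using assms
proof (induction I rule: finite_ne_induct)
  case (insert i I)
  have "dominated K (\<lambda>x. max (u i x) (Max ((\<lambda>i. u i x) ` I)))"
    by (rule dominated_max) (simp_all add: insert)
  with insert.hyps show ?case by simp
qed simp

lemma dominated_Min:
  assumes "finite I" and "I \<noteq> {}" and "\<And>i. i \<in> I \<Longrightarrow> dominated K (u i)"
  shows "dominated K (\<lambda>x. Min ((\<lambda>i. u i x) ` I))"
  using assms
proof (induction I rule: finite_ne_induct)
  case (insert i I)
  have "dominated K (\<lambda>x. min (u i x) (Min ((\<lambda>i. u i x) ` I)))"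
    by (rule dominated_min) (simp_all add: insert)
  with insert.hyps show ?case by simp
qed simp

text \<open>The majorant \<open>w\<close> turns pointwise convergence into L^p convergence by
  dominated convergence; with bounded energies, lower semicontinuity carries the setwise estimate to
  the limit.\<close>

lemma dominated_pointwise_limit:
  assumes u: "\<And>k::nat. dominated K (u k)" and "0 \<le> K"
    and w: "w \<in> F" "\<And>k x. \<bar>u k x\<bar> \<le> w x"
    and lim: "\<And>x. (\<lambda>k. u k x) \<longlonglongrightarrow> v x"
  shows "dominated K v"
proof -
  have uF: "u k \<in> F" for k
    using u[of k] by (simp add: dominated_def)
  have [measurable]: "u k \<in> borel_measurable M" for k
    using uF by (rule F_measurable)
  have [measurable]: "v \<in> borel_measurable M"
    by (rule borel_measurable_LIMSEQ_real[of _ u]) (simp_all add: lim)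
  have v_le: "\<bar>v x\<bar> \<le> w x" for x
    using tendsto_rabs[OF lim] by (rule LIMSEQ_le_const2) (use w in auto)
  have w_nonneg: "0 \<le> w x" for x
    using w(2)[of 0 x] by simp
  have [measurable]: "w \<in> borel_measurable M"
    using w(1) by (rule F_measurable)
  have w_int: "integrable M (\<lambda>x. \<bar>w x\<bar> powr p)"
    using w(1) F_subset_Lp by (auto simp: Lp_space_def)
  have v_Lp: "v \<in> Lp_space p M"
  proof -
    have "integrable M (\<lambda>x. \<bar>v x\<bar> powr p)"
      using w_int
    proof (rule Bochner_Integration.integrable_bound)
      show "AE x in M. norm (\<bar>v x\<bar> powr p) \<le> norm (\<bar>w x\<bar> powr p)"
        using v_le w_nonneg p_pos by (auto intro!: AE_I2 powr_mono2)
    qed simp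
    then show ?thesis by (simp add: Lp_space_def)
  qed
  \<comment> \<open>Both \<open>u k\<close> and \<open>v\<close> are bounded by \<open>w\<close>,
    hence the factor \<open>2 powr p\<close>.\<close>
  have "(\<lambda>k. LINT x|M. \<bar>u k x - v x\<bar> powr p) \<longlonglongrightarrow> (LINT x|M. 0)"
  proof (rule integral_dominated_convergence[where w = "\<lambda>x. 2 powr p * \<bar>w x\<bar> powr p"])
    show "integrable M (\<lambda>x. 2 powr p * \<bar>w x\<bar> powr p)"
      using w_int by simp
    show "AE x in M. (\<lambda>k. \<bar>u k x - v x\<bar> powr p) \<longlonglongrightarrow> 0"
    proof (rule AE_I2)
      fix x
      have "(\<lambda>k. \<bar>u k x - v x\<bar>) \<longlonglongrightarrow> 0"
        using lim[of x] by (simp add: tendsto_rabs_zero_iff LIM_zero)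
      then show "(\<lambda>k. \<bar>u k x - v x\<bar> powr p) \<longlonglongrightarrow> 0"
        using p_pos by (intro tendsto_zero_powrI[OF _ tendsto_const]) auto
    qed
    show "AE x in M. norm (\<bar>u k x - v x\<bar> powr p) \<le> 2 powr p * \<bar>w x\<bar> powr p" for k
    proof (rule AE_I2)
      fix x
      have "\<bar>u k x - v x\<bar> \<le> 2 * \<bar>w x\<bar>"
        using w(2)[of k x] v_le[of x] by linarith
      then have "\<bar>u k x - v x\<bar> powr p \<le> (2 * \<bar>w x\<bar>) powr p"
        using p_pos by (intro powr_mono2) auto
      then show "norm (\<bar>u k x - v x\<bar> powr p) \<le> 2 powr p * \<bar>w x\<bar> powr p"
        by (simp add: powr_mult)
    qed
  qed simp_all
  then have "(\<lambda>k. (LINT x|M. \<bar>u k x - v x\<bar> powr p) powr (1 / p)) \<longlonglongrightarrow> 0"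
    using p_pos by (intro tendsto_zero_powrI[OF _ tendsto_const]) auto
  then have conv: "(\<lambda>k. Lp_norm p M (\<lambda>x. u k x - v x)) \<longlonglongrightarrow> 0"
    by (simp add: Lp_norm_def)
  \<comment> \<open>Testing the bound on the whole space controls the energies uniformly in
    \<open>k\<close>, because \<open>\<sigma>\<close> is finite.\<close>
  have "E (u k) \<le> K * (\<Sum>i\<in>UNIV. measure (\<Gamma> (f i)) (space M))" for k
  proof -
    have "emeasure (\<Gamma> (u k)) (space M) \<le> ennreal K * emeasure \<sigma> (space M)"
      using u[of k] by (auto simp: dominated_def)
    then have "ennreal (E (u k)) \<le> ennreal (K * (\<Sum>i\<in>UNIV. measure (\<Gamma> (f i)) (space M)))"
      using \<open>0 \<le> K\<close> by (simp add: emeasure_\<Gamma>[OF uF] \<Gamma>_total[OF uF] emeasure_\<sigma> ennreal_mult sum_nonneg)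
    then show ?thesis
      using \<open>0 \<le> K\<close> by (subst (asm) ennreal_le_iff) (auto intro!: mult_nonneg_nonneg sum_nonneg)
  qed
  then have "bdd_above (range (\<lambda>k. E (u k)))"
    by (intro bdd_aboveI2)
  from lower_semicontinuity[OF v_Lp uF conv this]
  have v: "v \<in> F" "\<And>A. A \<in> sets M \<Longrightarrow> emeasure (\<Gamma> v) A \<le> liminf (\<lambda>k. emeasure (\<Gamma> (u k)) A)"
    by auto
  moreover have "liminf (\<lambda>k. emeasure (\<Gamma> (u k)) A) \<le> ennreal K * emeasure \<sigma> A"
    if "A \<in> sets M" for A
    by (intro Liminf_le) (use u that in \<open>auto simp: dominated_def\<close>)
  ultimately show ?thesis
    unfolding dominated_def using order_trans by blast
qed

section \<open>Lipschitz functions with a global constant\<close>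

text \<open>The approximants \<open>h k\<close> are minima of finitely many maxima of affine
  functions with slope at most \<open>L'\<close>, hence dominated, and they converge pointwise to
  \<open>g\<close>. The room between \<open>L\<close> and \<open>L'\<close> allows finitely many
  directions per cone.\<close>

lemma dominated_lipschitz:
  fixes g :: "real ^ 'n \<Rightarrow> real"
  assumes g: "L-lipschitz_on UNIV g" and "L < L'"
  shows "dominated (C * L' powr p) (\<lambda>x. g (fvec x))"
proof -
  have L: "0 \<le> L"
    using g by (rule lipschitz_on_nonneg)
  have g_le: "g y \<le> g z + L * norm (y - z)" for y z
    using lipschitz_onD[OF g, of y z] by (simp add: dist_real_def dist_norm)
  obtain V :: "(real ^ 'n) set" where V: "finite V" "V \<noteq> {}" "\<And>v. v \<in> V \<Longrightarrow> norm v \<le> 1"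
    "\<And>w. \<exists>v\<in>V. L * norm w \<le> L' * (v \<bullet> w)"
    using finite_directions_norming[OF L \<open>L < L'\<close>] by blast
  obtain D :: "(real ^ 'n) set" where D: "countable D" "\<And>X. open X \<Longrightarrow> X \<noteq> {} \<Longrightarrow> \<exists>d\<in>D. d \<in> X"
    by (rule countable_dense_setE) blast
  have "D \<noteq> {}"
    using D(2)[of UNIV] by auto
  define z where "z = from_nat_into D"
  have z: "range z = D"
    unfolding z_def using \<open>D \<noteq> {}\<close> D(1) by (rule range_from_nat_into)
  \<comment> \<open>A polyhedral stand-in for \<open>g (z j) + L' * norm (y - z j)\<close>: it lies
    below that round cone, yet above \<open>g\<close> by the norming property of
    \<open>V\<close>.\<close>
  define cone where "cone j y = Max ((\<lambda>v. g (z j) + L' * (v \<bullet> (y - z j))) ` V)" for j y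
  define h where "h k y = Min ((\<lambda>j. cone j y) ` {..k})" for k :: nat and y
  have cone_ge: "g y \<le> cone j y" for j y
  proof -
    obtain v where v: "v \<in> V" "L * norm (y - z j) \<le> L' * (v \<bullet> (y - z j))"
      using V(4) by blast
    have "g y \<le> g (z j) + L' * (v \<bullet> (y - z j))"
      using g_le[of y "z j"] v by simp
    also have "\<dots> \<le> cone j y"
      unfolding cone_def using V v by (intro Max_ge) auto
    finally show ?thesis .
  qed
  have cone_le: "cone j y \<le> g (z j) + L' * norm (y - z j)" for j y
    unfolding cone_def
  proof (rule Max.boundedI)
    fix a assume "a \<in> (\<lambda>v. g (z j) + L' * (v \<bullet> (y - z j))) ` V"
    then obtain v where v: "v \<in> V" "a = g (z j) + L' * (v \<bullet> (y - z j))"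
      by auto
    have "v \<bullet> (y - z j) \<le> norm v * norm (y - z j)"
      by (rule norm_cauchy_schwarz)
    also have "\<dots> \<le> 1 * norm (y - z j)"
      using V(3)[OF v(1)] by (intro mult_right_mono) auto
    finally show "a \<le> g (z j) + L' * norm (y - z j)"
      using v L \<open>L < L'\<close> by (simp add: mult_left_mono)
  qed (use V in auto)
  have h_ge: "g y \<le> h k y" for k y
    unfolding h_def using cone_ge by (intro Min.boundedI) auto
  have h_le: "h k y \<le> g (z j) + L' * norm (y - z j)" if "j \<le> k" for j k y
  proof -
    have "h k y \<le> cone j y"
      unfolding h_def using that by (intro Min_le) auto
    also note cone_le
    finally show ?thesis .
  qed
  have lim: "(\<lambda>k. h k y) \<longlonglongrightarrow> g y" for y
  proof (rule LIMSEQ_I)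
    fix e :: real assume "0 < e"
    \<comment> \<open>Once \<open>j \<le> k\<close>, the error at \<open>y\<close> is at most
      \<open>(L + L') * norm (y - z j)\<close>: \<open>L\<close> from the change of
      \<open>g\<close>, \<open>L'\<close> from the cone.\<close>
    define d where "d = e / (L + L')"
    have "0 < d"
      using \<open>0 < e\<close> L \<open>L < L'\<close> by (simp add: d_def)
    then obtain j where j: "dist y (z j) < d"
      using D(2)[of "ball y d"] z by auto
    have "norm (h k y - g y) < e" if "j \<le> k" for k
    proof -
      have "h k y - g y \<le> g (z j) - g y + L' * norm (y - z j)"
        using h_le[OF that] by (simp add: algebra_simps)
      also have "\<dots> \<le> (L + L') * norm (y - z j)"
        using g_le[of "z j" y] by (simp add: algebra_simps norm_minus_commute)
      also have "\<dots> < (L + L') * d"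
        using j L \<open>L < L'\<close> by (intro mult_strict_left_mono) (auto simp: dist_norm)
      also have "\<dots> = e"
        using L \<open>L < L'\<close> by (simp add: d_def)
      finally show ?thesis
        using h_ge[of y k] by simp
    qed
    then show "\<exists>k0. \<forall>k\<ge>k0. norm (h k y - g y) < e"
      by blast
  qed
  \<comment> \<open>One majorant for all \<open>h k\<close>: the cone with index 0 bounds them
    above, \<open>g\<close> bounds them below, and the Euclidean norm of \<open>fvec x\<close> is
    replaced by the larger sum of the \<open>\<bar>f i x\<bar>\<close>, which lies in
    \<open>F\<close>.\<close>
  define w where "w x = (\<bar>g 0\<bar> + \<bar>g (z 0)\<bar> + L' * norm (z 0)) + L' * (\<Sum>i\<in>UNIV. \<bar>f i x\<bar>)" for x
  show ?thesis
  proof (rule dominated_pointwise_limit)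
    show "dominated (C * L' powr p) (\<lambda>x. h k (fvec x))" for k
      unfolding h_def cone_def
    proof (intro dominated_Min dominated_Max V)
      fix j v assume v: "v \<in> V"
      \<comment> \<open>Each piece of a cone is affine with gradient
        \<open>L' *\<^sub>R v\<close>.\<close>
      have "norm (L' *\<^sub>R v) \<le> L'"
        using V(3)[OF v] L \<open>L < L'\<close> by (simp add: mult_left_le)
      then have "dominated (C * L' powr p) (\<lambda>x. (g (z j) - L' * (v \<bullet> z j)) + (L' *\<^sub>R v) \<bullet> fvec x)"
        by (rule dominated_affine)
      then show "dominated (C * L' powr p) (\<lambda>x. g (z j) + L' * (v \<bullet> (fvec x - z j)))"
        by (simp add: algebra_simps)
    qed auto
    show "0 \<le> C * L' powr p"
      using C_ge_1 by simp
    show "w \<in> F"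
      unfolding w_def[abs_def] by (intro F_add F_const F_scale F_sum F_abs f_in_F) auto
    show "\<bar>h k (fvec x)\<bar> \<le> w x" for k x
    proof -
      let ?y = "fvec x"
      have "norm ?y \<le> (\<Sum>i\<in>UNIV. \<bar>f i x\<bar>)"
        using norm_le_l1_cart[of ?y] by (simp add: fvec_def)
      then have 1: "L' * norm ?y \<le> L' * (\<Sum>i\<in>UNIV. \<bar>f i x\<bar>)"
        using L \<open>L < L'\<close> by (intro mult_left_mono) auto
      have "L' * norm (?y - z 0) \<le> L' * (norm ?y + norm (z 0))"
        using L \<open>L < L'\<close> by (intro mult_left_mono norm_triangle_ineq4) auto
      then have "h k ?y \<le> g (z 0) + L' * norm ?y + L' * norm (z 0)"
        using h_le[of 0 k ?y] by (simp add: algebra_simps)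
      moreover have "g 0 \<le> h k ?y + L * norm ?y"
        using g_le[of 0 ?y] h_ge[of ?y k] by simp
      moreover have "L * norm ?y \<le> L' * norm ?y"
        using \<open>L < L'\<close> by (intro mult_right_mono) auto
      moreover have "0 \<le> L' * norm (z 0)"
        using L \<open>L < L'\<close> by simp
      ultimately show ?thesis
        unfolding w_def using 1 by linarith
    qed
    show "(\<lambda>k. h k (fvec x)) \<longlonglongrightarrow> g (fvec x)" for x
      by (rule lim)
  qed
qed

section \<open>From the global to the pointwise constant\<close>

text \<open>Near each value \<open>fvec x\<close> the function \<open>g\<close> has a constant
  \<open>c' < c\<close> and agrees with a global extension having that constant. The extension obeys
  \<open>dominated_lipschitz\<close>, and locality transfers its bound back to
  \<open>g\<close>.\<close>

lemma emeasure_\<Gamma>_le_of_Lip_a_less: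
  fixes g :: "real ^ 'n \<Rightarrow> real"
  assumes g: "L-lipschitz_on UNIV g" and A: "A \<in> sets M"
    and less: "\<And>x. x \<in> A \<Longrightarrow> Lip_a g (fvec x) < c"
  shows "emeasure (\<Gamma> (\<lambda>x. g (fvec x))) A \<le> ennreal (C * c powr p) * emeasure \<sigma> A"
proof -
  let ?u = "\<lambda>x. g (fvec x)"
  \<comment> \<open>Only membership in \<open>F\<close> is extracted; \<open>L + 1\<close> stands
    for any number above \<open>L\<close>.\<close>
  have gF: "?u \<in> F"
    using dominated_lipschitz[OF g, of "L + 1"] by (simp add: dominated_def)
  \<comment> \<open>Members are nonempty for the extension lemma and open for the Lindelof property,
    which provides the countable cover.\<close>
  define \<U> where "\<U> = {U. open U \<and> U \<noteq> {} \<and> (\<exists>c'<c. c'-lipschitz_on U g)}"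
  obtain \<U>' where \<U>': "\<U>' \<subseteq> \<U>" "countable \<U>'" "\<Union>\<U>' = \<Union>\<U>"
    using Lindelof[of \<U>] by (auto simp: \<U>_def)
  have cover: "fvec x \<in> \<Union>\<U>" if x: "x \<in> A" for x
  proof -
    obtain r c' where "0 < r" "c' < c" "c'-lipschitz_on (ball (fvec x) r) g"
      using Lip_a_less_imp_lipschitz_on_ball[OF g less[OF x]] .
    then have "ball (fvec x) r \<in> \<U>"
      by (auto simp: \<U>_def)
    with \<open>0 < r\<close> show ?thesis
      by (metis UnionI centre_in_ball)
  qed
  have "emeasure (\<Gamma> ?u) A \<le> emeasure (scale_measure (ennreal (C * c powr p)) \<sigma>) A"
  proof (rule emeasure_le_of_countable_cover[where \<B> = "(\<lambda>U. fvec -` U \<inter> space M) ` \<U>'"])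
    show "A \<subseteq> \<Union> ((\<lambda>U. fvec -` U \<inter> space M) ` \<U>')"
    proof
      fix x assume "x \<in> A"
      with cover \<U>'(3) obtain U where "U \<in> \<U>'" "fvec x \<in> U"
        by (metis UnionE)
      then show "x \<in> \<Union> ((\<lambda>U. fvec -` U \<inter> space M) ` \<U>')"
        using \<open>x \<in> A\<close> sets.sets_into_space[OF A] by auto
    qed
    show "B \<in> sets (\<Gamma> ?u)" if "B \<in> (\<lambda>U. fvec -` U \<inter> space M) ` \<U>'" for B
      using that \<U>' by (auto simp: \<Gamma>_sets gF \<U>_def intro!: measurable_sets[OF fvec_measurable])
  next
    fix B D assume "B \<in> (\<lambda>U. fvec -` U \<inter> space M) ` \<U>'" and D: "D \<in> sets (\<Gamma> ?u)" "D \<subseteq> A \<inter> B"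
    then obtain U where "U \<in> \<U>'" and B: "B = fvec -` U \<inter> space M"
      by blast
    with \<U>'(1) obtain c' where U: "U \<noteq> {}" "c' < c" "c'-lipschitz_on U g"
      by (auto simp: \<U>_def)
    have DM: "D \<in> sets M"
      using D gF by (simp add: \<Gamma>_sets)
    obtain h where h: "c'-lipschitz_on UNIV h" "\<And>y. y \<in> U \<Longrightarrow> h y = g y"
      using lipschitz_extension[OF U(3,1)] by blast
    have "dominated (C * c powr p) (\<lambda>x. h (fvec x))"
      using h(1) U(2) by (rule dominated_lipschitz)
    then have hF: "(\<lambda>x. h (fvec x)) \<in> F"
      and "emeasure (\<Gamma> (\<lambda>x. h (fvec x))) D \<le> ennreal (C * c powr p) * emeasure \<sigma> D"
      using DM by (auto simp: dominated_def)
    moreover have "emeasure (\<Gamma> ?u) D \<le> emeasure (\<Gamma> (\<lambda>x. h (fvec x))) D"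
      using D B h(2) by (intro emeasure_\<Gamma>_le_of_diff_const[OF p_pos gF hF DM, of 0]) auto
    ultimately show "emeasure (\<Gamma> ?u) D \<le> emeasure (scale_measure (ennreal (C * c powr p)) \<sigma>) D"
      by simp
  qed (use A gF \<U>' in \<open>auto simp: \<Gamma>_sets\<close>)
  then show ?thesis by simp
qed

text \<open>On a slice where \<open>Lip_a\<close> lies in an interval of length \<open>e\<close>,
  the upper end exceeds the pointwise value by at most \<open>e\<close>. The uniform bounds on the
  slices thus merge into a single density.\<close>

lemma emeasure_\<Gamma>_le_Lip_a_add:
  fixes g :: "real ^ 'n \<Rightarrow> real"
  assumes g: "L-lipschitz_on UNIV g" and A: "A \<in> sets M" and "0 < e"
  shows "emeasure (\<Gamma> (\<lambda>x. g (fvec x))) A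
    \<le> emeasure (density \<sigma> (\<lambda>x. ennreal (C * (Lip_a g (fvec x) + e) powr p))) A"
proof -
  let ?u = "\<lambda>x. g (fvec x)"
  have [measurable]: "Lip_a g \<in> borel_measurable borel"
    using g by (rule borel_measurable_Lip_a)
  have gF: "?u \<in> F"
    using dominated_lipschitz[OF g, of "L + 1"] by (simp add: dominated_def)
  define B where "B k = {x\<in>space M. real k * e \<le> Lip_a g (fvec x) \<and> Lip_a g (fvec x) < (real k + 1) * e}"
    for k :: nat
  show ?thesis
  proof (rule emeasure_le_of_countable_cover[where \<B> = "range B"])
    show "A \<subseteq> \<Union> (range B)"
    proof
      fix x assume "x \<in> A"
      \<comment> \<open>The quotient is nonnegative, so \<open>nat\<close> loses nothing and
        \<open>k\<close> is its integer part.\<close>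
      define k where "k = nat \<lfloor>Lip_a g (fvec x) / e\<rfloor>"
      have "0 \<le> Lip_a g (fvec x) / e"
        using Lip_a_nonneg[OF g] \<open>0 < e\<close> by simp
      then have "real k \<le> Lip_a g (fvec x) / e" "Lip_a g (fvec x) / e < real k + 1"
        unfolding k_def by linarith+
      then have "x \<in> B k"
        using \<open>x \<in> A\<close> sets.sets_into_space[OF A] \<open>0 < e\<close> by (auto simp: B_def field_simps)
      then show "x \<in> \<Union> (range B)" by blast
    qed
    show "D \<in> sets (\<Gamma> ?u)" if "D \<in> range B" for D
      using that by (auto simp: \<Gamma>_sets[OF gF] B_def)
  next
    fix B' D assume "B' \<in> range B" and D: "D \<in> sets (\<Gamma> ?u)" "D \<subseteq> A \<inter> B'"
    then obtain k where Dk: "D \<subseteq> B k"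
      by auto
    have DM: "D \<in> sets M"
      using D gF by (simp add: \<Gamma>_sets)
    then have [measurable]: "D \<in> sets \<sigma>" by simp
    let ?c = "(real k + 1) * e"
    have "emeasure (\<Gamma> ?u) D \<le> ennreal (C * ?c powr p) * emeasure \<sigma> D"
      using Dk by (intro emeasure_\<Gamma>_le_of_Lip_a_less[OF g DM]) (auto simp: B_def)
    also have "\<dots> = (\<integral>\<^sup>+x. ennreal (C * ?c powr p) * indicator D x \<partial>\<sigma>)"
      by (rule nn_integral_cmult_indicator[symmetric]) fact
    also have "\<dots> \<le> (\<integral>\<^sup>+x. ennreal (C * (Lip_a g (fvec x) + e) powr p) * indicator D x \<partial>\<sigma>)"
    proof (rule nn_integral_mono)
      fix x
      \<comment> \<open>The lower edge of the slice gives
        \<open>real k * e \<le> Lip_a g (fvec x)\<close>.\<close>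
      have "C * ?c powr p \<le> C * (Lip_a g (fvec x) + e) powr p" if "x \<in> D"
        using that Dk C_ge_1 \<open>0 < e\<close> p_pos
        by (intro mult_left_mono powr_mono2) (auto simp: B_def algebra_simps)
      then show "ennreal (C * ?c powr p) * indicator D x
          \<le> ennreal (C * (Lip_a g (fvec x) + e) powr p) * indicator D x"
        by (auto simp: indicator_def intro!: ennreal_leI)
    qed
    also have "\<dots> = emeasure (density \<sigma> (\<lambda>x. ennreal (C * (Lip_a g (fvec x) + e) powr p))) D"
      by (intro emeasure_density[symmetric]) measurable
    finally show "emeasure (\<Gamma> ?u) D
      \<le> emeasure (density \<sigma> (\<lambda>x. ennreal (C * (Lip_a g (fvec x) + e) powr p))) D" .
  qed (use A gF in \<open>auto simp: \<Gamma>_sets\<close>)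
qed

text \<open>The slice width is sent to 0. Dominated convergence applies because \<open>Lip_a\<close>
  is at most \<open>L\<close> and \<open>\<sigma>\<close> is finite.\<close>

lemma chain_rule_vec:
  fixes g :: "real ^ 'n \<Rightarrow> real"
  assumes g: "L-lipschitz_on UNIV g"
  shows "(\<lambda>x. g (fvec x)) \<in> F"
    and "measure_le (\<Gamma> (\<lambda>x. g (fvec x))) (density \<sigma> (\<lambda>x. ennreal (C * Lip_a g (fvec x) powr p)))"
proof -
  let ?u = "\<lambda>x. g (fvec x)"
  show gF: "?u \<in> F"
    using dominated_lipschitz[OF g, of "L + 1"] by (simp add: dominated_def)
  have [measurable]: "Lip_a g \<in> borel_measurable borel"
    using g by (rule borel_measurable_Lip_a)
  have le_L: "Lip_a g y \<le> L" for y
    using g lipschitz_on_subset[OF g, of "ball y 1"] by (rule Lip_a_le) auto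
  have L: "0 \<le> L"
    using g by (rule lipschitz_on_nonneg)
  \<comment> \<open>The widths \<open>1 / real (Suc k)\<close> are positive and at most 1, whence
    the constant majorant with \<open>L + 1\<close>.\<close>
  define d where "d k x = ennreal (C * (Lip_a g (fvec x) + 1 / real (Suc k)) powr p)" for k x
  have d [measurable]: "d k \<in> borel_measurable \<sigma>" for k
    unfolding d_def[abs_def] by measurable
  have "emeasure (\<Gamma> ?u) A \<le> emeasure (density \<sigma> (\<lambda>x. ennreal (C * Lip_a g (fvec x) powr p))) A"
    if A: "A \<in> sets M" for A
  proof -
    have A' [measurable]: "A \<in> sets \<sigma>"
      using A by simp
    have "(\<lambda>k. \<integral>\<^sup>+x. d k x * indicator A x \<partial>\<sigma>)
      \<longlonglongrightarrow> (\<integral>\<^sup>+x. ennreal (C * Lip_a g (fvec x) powr p) * indicator A x \<partial>\<sigma>)"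
    proof (rule nn_integral_dominated_convergence[where w = "\<lambda>x. ennreal (C * (L + 1) powr p)"])
      show "(\<integral>\<^sup>+x. ennreal (C * (L + 1) powr p) \<partial>\<sigma>) < \<infinity>"
        by (simp add: emeasure_\<sigma> ennreal_mult_less_top)
      show "AE x in \<sigma>. d k x * indicator A x \<le> ennreal (C * (L + 1) powr p)" for k
      proof (rule AE_I2)
        fix x
        have "C * (Lip_a g (fvec x) + 1 / real (Suc k)) powr p \<le> C * (L + 1) powr p"
          using C_ge_1 p_pos le_L[of "fvec x"] Lip_a_nonneg[OF g, of "fvec x"]
          by (intro mult_left_mono powr_mono2 add_mono) auto
        then show "d k x * indicator A x \<le> ennreal (C * (L + 1) powr p)"
          by (auto simp: d_def indicator_def intro!: ennreal_leI)
      qed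
      show "AE x in \<sigma>. (\<lambda>k. d k x * indicator A x)
          \<longlonglongrightarrow> ennreal (C * Lip_a g (fvec x) powr p) * indicator A x"
      proof (rule AE_I2)
        fix x
        have "(\<lambda>k. Lip_a g (fvec x) + 1 / real (Suc k)) \<longlonglongrightarrow> Lip_a g (fvec x) + 0"
          by (intro tendsto_intros LIMSEQ_Suc[OF lim_1_over_n])
        \<comment> \<open>The limiting base may be 0, so continuity of the power is used for
          nonnegative bases and a positive exponent.\<close>
        then have "(\<lambda>k. d k x) \<longlonglongrightarrow> ennreal (C * Lip_a g (fvec x) powr p)"
          unfolding d_def using p_pos Lip_a_nonneg[OF g, of "fvec x"]
          by (intro tendsto_ennrealI tendsto_mult_left tendsto_powr2 tendsto_const) auto
        then show "(\<lambda>k. d k x * indicator A x)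
            \<longlonglongrightarrow> ennreal (C * Lip_a g (fvec x) powr p) * indicator A x"
          by (cases "x \<in> A") auto
      qed
    qed measurable
    moreover have "emeasure (\<Gamma> ?u) A \<le> (\<integral>\<^sup>+x. d k x * indicator A x \<partial>\<sigma>)" for k
      using emeasure_\<Gamma>_le_Lip_a_add[OF g A, of "1 / real (Suc k)"]
      unfolding d_def[symmetric] emeasure_density[OF d A'] by simp
    ultimately have "emeasure (\<Gamma> ?u) A
        \<le> (\<integral>\<^sup>+x. ennreal (C * Lip_a g (fvec x) powr p) * indicator A x \<partial>\<sigma>)"
      by (intro LIMSEQ_le_const) auto
    also have "\<dots> = emeasure (density \<sigma> (\<lambda>x. ennreal (C * Lip_a g (fvec x) powr p))) A"
      by (intro emeasure_density[symmetric]) measurable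
    finally show ?thesis .
  qed
  then show "measure_le (\<Gamma> ?u) (density \<sigma> (\<lambda>x. ennreal (C * Lip_a g (fvec x) powr p)))"
    by (simp add: measure_le_def \<Gamma>_sets[OF gF])
qed

end

theorem proposition2p61:
  fixes p :: real
    and M :: "'a measure"
    and E :: "('a \<Rightarrow> real) \<Rightarrow> real"
    and F :: "('a \<Rightarrow> real) set"
    and \<Gamma> :: "('a \<Rightarrow> real) \<Rightarrow> 'a measure"
    and g :: "real ^ 'n \<Rightarrow> real"
    and f :: "'n \<Rightarrow> 'a \<Rightarrow> real"
  assumes "1 < p"
    and "p_dirichlet_structure p M E F \<Gamma>"
    and "\<exists>L. L-lipschitz_on UNIV g"
    and "g 0 = 0"
    and "\<And>i. f i \<in> F"
  shows "(\<lambda>x. g (\<chi> i. f i x)) \<in> F \<and>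
    measure_le (\<Gamma> (\<lambda>x. g (\<chi> i. f i x)))
      (density (sum_measure M UNIV (\<lambda>i. \<Gamma> (f i)))
        (\<lambda>x. ennreal (max 1 (real CARD('n) powr ((p - 2) / 2))
                       * Lip_a g (\<chi> i. f i x) powr p)))"
proof -
  interpret p_dirichlet_tuple p M E F \<Gamma> f
    using assms by (intro p_dirichlet_tuple.intro p_dirichlet_tuple_axioms.intro)
  obtain L where "L-lipschitz_on UNIV g"
    using assms by blast
  from chain_rule_vec[OF this] show ?thesis
    unfolding \<sigma>_def C_def fvec_def by simp
qed

end
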